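(* Let $A(t,y,x)=\sum_{n\ge 0}t^n\sum_{\sigma\in\mathcal S_n(123)}y^{\mathrm{des}(\sigma)}x^{321\text{-mch}(\sigma)}$. Then $$\begin{aligned} A(t,y,x)=1- \frac{1}{2 t y^2 \left(-x^2 t y+x+t\right)^3} \Big(&2 (x-1)^2 t^6 y^3 \left(x^2 y-1\right)^2+t^2 \left(-x^2 (2x+5) y^2+(6 x+2) y-1\right)\\ &+2 t^4 y \left((2-3 x) x^4y^3+\left(3 x^2+2 x-2\right) x^2 y^2-\left(3x^2+x-1\right) y+1\right)\\ &+2 (x-1) t^5 y^2 \left(x^5y^3-3 x^4 y^2+4 x^2 y-x y-1\right)\\ &+2 t^3 y \left(3 x^4y^2-x^3 y-5 x^2 y+x+2\right)+t (4 x y-2)-1\\ &+(t (x y-1)-1)^2\sqrt{4 x^2 t^2 y^2-4 x t y-4 t^2 y+1}\Big). \end{aligned}$$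
   Context: $\mathcal S_n$ is the set of permutations of $\{1,\dots,n\}$ in one-line notation ($\mathcal S_0$ contains only the empty permutation, on which all statistics are $0$). For a word $w$ of distinct integers, $\mathrm{red}(w)$ replaces the $i$-th smallest letter by $i$. $\sigma\in\mathcal S_n$ avoids $\lambda\in\mathcal S_k$ (classical avoidance) if no (not necessarily contiguous) subsequence $\sigma_{i_1}\cdots\sigma_{i_k}$, $i_1<\dots<i_k$, has reduction $\lambda$; $\mathcal S_n(\lambda)$ is the set of such $\sigma$. $\gamma\text{-mch}(\sigma)$ is the number of $i$ with $\mathrm{red}(\sigma_i\sigma_{i+1}\cdots\sigma_{i+k-1})=\gamma$ for $\gamma\in\mathcal S_k$. $\mathrm{des}(\sigma)=|\{i:\sigma_i>\sigma_{i+1}\}|$. The identity is one of formal power series in $t$ over $\mathbb Q[x,y]$ (quotients taken in the fraction field), and the square root is the power series in $t$ with constant term $1$. *)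

theory Defs
  imports
    "HOL-Computational_Algebra.Formal_Power_Series"
    "HOL-Computational_Algebra.Polynomial_Factorial"
    "HOL-Combinatorics.Multiset_Permutations"
    "HOL-Library.Sublist"
begin

definition red :: "'a::linorder list \<Rightarrow> nat list" where
  "red w = map (\<lambda>a. card {b \<in> set w. b \<le> a}) w"

text \<open>\<open>subseq\<close> is the library's notion of a not necessarily contiguous sublist.\<close>

definition avoids :: "'a::linorder list \<Rightarrow> nat list \<Rightarrow> bool" where
  "avoids \<sigma> \<tau> \<longleftrightarrow> \<not> (\<exists>v. subseq v \<sigma> \<and> red v = \<tau>)"

text \<open>Permutations of $\{1,\dots,n\}$ in one-line notation are lists of length $n$;
  positions of a list are counted from \<open>0\<close>.\<close>

definition avoiding_perms :: "nat \<Rightarrow> nat list \<Rightarrow> nat list set" where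
  "avoiding_perms n \<tau> = {\<sigma> \<in> permutations_of_set {1..n}. avoids \<sigma> \<tau>}"

definition mch :: "nat list \<Rightarrow> 'a::linorder list \<Rightarrow> nat" where
  "mch \<gamma> \<sigma> =
     card {i. i + length \<gamma> \<le> length \<sigma> \<and> red (take (length \<gamma>) (drop i \<sigma>)) = \<gamma>}"

definition des :: "'a::linorder list \<Rightarrow> nat" where
  "des \<sigma> = card {i. Suc i < length \<sigma> \<and> \<sigma> ! i > \<sigma> ! Suc i}"

text \<open>The ring $\mathbb{Q}[x,y]$ is \<open>rat poly poly\<close>, that is, $\mathbb{Q}[x][y]$: the inner
  polynomial variable is $x$ and the outer one is $y$. The ring $\mathbb{Q}[x,y][[t]]$ is
  \<open>rat poly poly fps\<close>, with $t$ being \<open>fps_X\<close>, and its fraction field is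
  \<open>rat poly poly fps fract\<close>.\<close>

definition var_x :: "rat poly poly" where
  "var_x = [:[:0, 1:]:]"

definition var_y :: "rat poly poly" where
  "var_y = [:0, 1:]"

definition A_series :: "rat poly poly fps" where
  "A_series = Abs_fps (\<lambda>n. \<Sum>\<sigma>\<in>avoiding_perms n [1, 2, 3].
     var_y ^ des \<sigma> * var_x ^ mch [3, 2, 1] \<sigma>)"

text \<open>The library's \<open>fps_radical\<close> needs coefficients in a field, so the square root with
  constant term \<open>1\<close> is introduced by description; lemma \<open>sqrt_fps\<close> below shows that
  it is well defined over $\mathbb{Q}[x,y]$.\<close>

definition sqrt_fps :: "'a::comm_ring_1 fps \<Rightarrow> 'a fps" where
  "sqrt_fps f = (THE g. g ^ 2 = f \<and> fps_nth g 0 = 1)"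

lemma sqrt_fps_unique:
  fixes g h :: "'a::{idom, ring_char_0} fps"
  assumes "g ^ 2 = h ^ 2" "fps_nth g 0 = 1" "fps_nth h 0 = 1"
  shows "g = h"
proof -
  have "fps_nth (g + h) 0 \<noteq> 0"
    using assms by simp
  then have "g + h \<noteq> 0"
    by (metis fps_zero_nth)
  moreover have "(g - h) * (g + h) = 0"
    using assms(1) by (simp add: algebra_simps power2_eq_square)
  ultimately show ?thesis by simp
qed

lemma sqrt_fps:
  fixes f :: "rat poly poly fps"
  assumes "fps_nth f 0 = 1"
  shows "sqrt_fps f ^ 2 = f" and "fps_nth (sqrt_fps f) 0 = 1"
proof -
  define c :: "rat \<Rightarrow> rat poly poly" where "c q = [:[:q:]:]" for q
  have c_add: "c (a + b) = c a + c b" and c_mult: "c (a * b) = c a * c b"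
    and c_0: "c 0 = 0" and c_1: "c 1 = 1" for a b
    by (simp_all add: c_def one_pCons)
  have c_sum: "c (sum h S) = (\<Sum>i\<in>S. c (h i))" for h :: "nat \<Rightarrow> rat" and S
    by (induction S rule: infinite_finite_induct) (simp_all add: c_add c_0)
  define b :: "rat fps" where "b = fps_binomial (1/2)"
  define s where "s = Abs_fps (\<lambda>n. c (fps_nth b n))"
  have bb: "b * b = 1 + fps_X"
    unfolding b_def by (simp flip: fps_binomial_add_mult add: fps_binomial_1)
  have "fps_nth (s * s) n = c (fps_nth (b * b) n)" for n
    by (simp add: s_def fps_mult_nth c_sum c_mult)
  then have ss: "s * s = 1 + fps_X"
    by (intro fps_ext) (auto simp: bb c_add c_0 c_1)
  define g where "g = s oo (f - 1)"
  have f0: "fps_nth (f - 1) 0 = 0" using assms by simp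
  have "g ^ 2 = (s * s) oo (f - 1)"
    by (simp add: g_def power2_eq_square fps_compose_mult_distrib[OF f0])
  also have "\<dots> = f"
    using f0 by (simp add: ss fps_compose_add_distrib)
  finally have g: "g ^ 2 = f" .
  have g0: "fps_nth g 0 = 1"
    by (simp add: g_def s_def b_def c_1)
  have "sqrt_fps f ^ 2 = f \<and> fps_nth (sqrt_fps f) 0 = 1"
    unfolding sqrt_fps_def
    by (rule theI[of _ g]) (use g g0 in \<open>auto intro: sqrt_fps_unique\<close>)
  then show "sqrt_fps f ^ 2 = f" and "fps_nth (sqrt_fps f) 0 = 1" by simp_all
qed

end

theory Submission
  imports Defs
begin

text \<open>Prepending a letter \<open>a\<close> to a 123-avoiding permutation of length \<open>n\<close>, with relabelling,
  keeps it 123-avoiding iff \<open>a\<close> exceeds the largest letter \<open>k\<close> that is the bottom of some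
  ascending pair (\<open>k = 0\<close> if there is none). With \<open>h = n - k\<close>, the choice \<open>a = n + 1\<close> leads to
  height \<open>h + 1\<close>, and the other choices lead to the heights \<open>1, \<dots>, h\<close>. The first letter is
  always \<open>n\<close> or \<open>k\<close>, and the new descents and 321-matches depend only on which of these it is and
  on whether the first step is a descent, so finitely many states \<open>s\<close> suffice.

  The generating functions $F_s(h)$ of the extensions of a permutation in state $s$ at height $h$
  satisfy a linear system that has a unique solution, by comparison of the powers of $t$. Its
  characteristic equation has the double root $1$ and the power series root $U$ with
  $U - 1 = t y E U^2$, where $E = x + t - t x^2 y$. Hence $F_s(h)$ is a combination of $1$, $h$ and
  $U^h$, and $U = 2/(1 + \sqrt{1 - 4 t y E})$ brings in the square root.\<close>

subsection \<open>Prepending a letter\<close>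

text \<open>The order-preserving relabelling that skips the value \<open>a\<close>, making room for
  a new letter \<open>a\<close>.\<close>

definition gap_map :: "nat \<Rightarrow> nat \<Rightarrow> nat" where
  "gap_map a v = (if v < a then v else Suc v)"

definition prepend :: "nat \<Rightarrow> nat list \<Rightarrow> nat list" where
  "prepend a \<pi> = a # map (gap_map a) \<pi>"

lemma gap_map_less_iff [simp]: "gap_map a u < gap_map a v \<longleftrightarrow> u < v"
  by (auto simp: gap_map_def)

lemma gap_map_less_self_iff [simp]: "gap_map a v < a \<longleftrightarrow> v < a"
  by (auto simp: gap_map_def)

lemma less_gap_map_self_iff [simp]: "a < gap_map a v \<longleftrightarrow> a \<le> v"
  by (auto simp: gap_map_def)

lemma gap_map_le_self_iff [simp]: "gap_map a v \<le> a \<longleftrightarrow> v < a"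
  by (auto simp: gap_map_def)

lemma strict_mono_gap_map: "strict_mono (gap_map a)"
  by (simp add: strict_mono_def)

lemma gap_map_image:
  assumes "a \<in> {1..Suc n}"
  shows "gap_map a ` {1..n} = {1..Suc n} - {a}"
proof (intro equalityI subsetI)
  fix v assume v: "v \<in> {1..Suc n} - {a}"
  show "v \<in> gap_map a ` {1..n}"
  proof (cases "v < a")
    case True
    then show ?thesis using v assms
      by (intro image_eqI[of _ _ v]) (auto simp: gap_map_def)
  next
    case False
    then show ?thesis using v assms
      by (intro image_eqI[of _ _ "v - 1"]) (auto simp: gap_map_def)
  qed
qed (use assms in \<open>auto simp: gap_map_def\<close>)

lemma length_prepend [simp]: "length (prepend a \<pi>) = Suc (length \<pi>)"
  by (simp add: prepend_def)

lemma permutations_of_set_Suc: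
  "permutations_of_set {1..Suc n} =
     (\<Union>a\<in>{1..Suc n}. prepend a ` permutations_of_set {1..n})"
proof -
  have "permutations_of_set ({1..Suc n} - {a}) = map (gap_map a) ` permutations_of_set {1..n}"
    if "a \<in> {1..Suc n}" for a
    unfolding gap_map_image[OF that, symmetric]
    by (intro permutations_of_set_image_inj strict_mono_imp_inj_on strict_mono_gap_map)
  then have "(\<Union>a\<in>{1..Suc n}. (#) a ` permutations_of_set ({1..Suc n} - {a})) =
      (\<Union>a\<in>{1..Suc n}. prepend a ` permutations_of_set {1..n})"
    by (intro SUP_cong refl) (simp add: image_image prepend_def)
  then show ?thesis
    by (subst permutations_of_set_nonempty) auto
qed

section \<open>Patterns 123 and 321 as inequalities between letters\<close>

lemma red_eq_123_iff: "red v = [1, 2, 3] \<longleftrightarrow> (\<exists>a b c. v = [a, b, c] \<and> a < b \<and> b < c)"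
proof
  assume red: "red v = [1, 2, 3]"
  then have "length v = 3"
    by (metis length_map red_def length_Cons list.size(3) numeral_3_eq_3)
  then obtain a b c where v: "v = [a, b, c]"
    by (auto simp: numeral_3_eq_3 length_Suc_conv)
  let ?r = "\<lambda>z. card {u \<in> set v. u \<le> z}"
  \<comment> \<open>Ranks are weakly monotone in the letter, so strictly larger ranks force strictly
    larger letters.\<close>
  have mono: "?r z \<le> ?r z'" if "z \<le> z'" for z z'
    using that by (intro card_mono) auto
  have "?r a = 1" "?r b = 2" "?r c = 3"
    using red by (simp_all add: red_def v)
  then have "a < b" "b < c"
    using mono[of b a] mono[of c b] by (auto simp: not_less[symmetric])
  then show "\<exists>a b c. v = [a, b, c] \<and> a < b \<and> b < c"
    using v by blast
next
  assume "\<exists>a b c. v = [a, b, c] \<and> a < b \<and> b < c"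
  then obtain a b c where v: "v = [a, b, c]" and less: "a < b" "b < c" by blast
  then have "{u. (u = a \<or> u = b \<or> u = c) \<and> u \<le> a} = {a}"
    "{u. (u = a \<or> u = b \<or> u = c) \<and> u \<le> b} = {a, b}"
    "{u. (u = a \<or> u = b \<or> u = c) \<and> u \<le> c} = {a, b, c}"
    by auto
  then show "red v = [1, 2, 3]"
    using less by (auto simp: red_def v)
qed

lemma red_eq_321_iff: "red [a, b, c] = [3, 2, 1] \<longleftrightarrow> a > b \<and> b > c"
proof
  assume red: "red [a, b, c] = [3, 2, 1]"
  let ?r = "\<lambda>z. card {u \<in> set [a, b, c]. u \<le> z}"
  have mono: "?r z \<le> ?r z'" if "z \<le> z'" for z z'
    using that by (intro card_mono) auto
  have "?r a = 3" "?r b = 2" "?r c = 1"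
    using red by (simp_all add: red_def)
  then show "a > b \<and> b > c"
    using mono[of a b] mono[of b c] by (auto simp: not_less[symmetric])
next
  assume less: "a > b \<and> b > c"
  then have "{u. (u = a \<or> u = b \<or> u = c) \<and> u \<le> a} = {a, b, c}"
    "{u. (u = a \<or> u = b \<or> u = c) \<and> u \<le> b} = {b, c}"
    "{u. (u = a \<or> u = b \<or> u = c) \<and> u \<le> c} = {c}"
    by auto
  then show "red [a, b, c] = [3, 2, 1]"
    using less by (auto simp: red_def)
qed

lemma mch_321:
  "mch [3, 2, 1] \<sigma> =
     card {i. Suc (Suc i) < length \<sigma> \<and> \<sigma> ! i > \<sigma> ! Suc i \<and> \<sigma> ! Suc i > \<sigma> ! Suc (Suc i)}"
proof -
  have "i + length [3, 2, 1 :: nat] \<le> length \<sigma> \<and>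
      red (take (length [3, 2, 1 :: nat]) (drop i \<sigma>)) = [3, 2, 1]
      \<longleftrightarrow> Suc (Suc i) < length \<sigma> \<and> \<sigma> ! i > \<sigma> ! Suc i \<and> \<sigma> ! Suc i > \<sigma> ! Suc (Suc i)" for i
  proof (cases "Suc (Suc i) < length \<sigma>")
    case True
    then have "take (length [3, 2, 1 :: nat]) (drop i \<sigma>) = [\<sigma> ! i, \<sigma> ! Suc i, \<sigma> ! Suc (Suc i)]"
      by (simp add: Cons_nth_drop_Suc[symmetric])
    with True show ?thesis
      by (simp only: red_eq_321_iff) simp
  qed simp
  then show ?thesis
    unfolding mch_def by simp
qed

text \<open>Isolates position 0: a new first letter affects only the window that starts there, all
  others being shifted by one.\<close>

lemma card_Collect_nat_shift:
  assumes "finite {i. P (Suc i)}"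
  shows "card {i. P i} = of_bool (P 0) + card {i. P (Suc i)}"
proof -
  have "{i. P i} = {i. i = 0 \<and> P 0} \<union> Suc ` {i. P (Suc i)}"
  proof (intro set_eqI)
    show "i \<in> {i. P i} \<longleftrightarrow> i \<in> {i. i = 0 \<and> P 0} \<union> Suc ` {i. P (Suc i)}" for i
      by (cases i) auto
  qed
  moreover have "card ({i. i = 0 \<and> P 0} \<union> Suc ` {i. P (Suc i)}) =
      card {i :: nat. i = 0 \<and> P 0} + card {i. P (Suc i)}"
    using assms by (subst card_Un_disjoint) (auto simp: card_image)
  ultimately show ?thesis by (cases "P 0") auto
qed

lemma des_Cons_Cons: "des (a # b # w) = of_bool (b < a) + des (b # w)"
  unfolding des_def by (subst card_Collect_nat_shift) auto

lemma mch_321_Cons_Cons_Cons: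
  "mch [3, 2, 1] (a # b # c # w) = of_bool (c < b \<and> b < a) + mch [3, 2, 1] (b # c # w)"
  unfolding mch_321 by (subst card_Collect_nat_shift) auto

lemma des_map: "strict_mono f \<Longrightarrow> des (map f w) = des w"
  unfolding des_def
  by (intro arg_cong[where f = card] Collect_cong) (auto simp: strict_mono_less)

lemma mch_321_map: "strict_mono f \<Longrightarrow> mch [3, 2, 1] (map f w) = mch [3, 2, 1] w"
  unfolding mch_321
  by (intro arg_cong[where f = card] Collect_cong) (auto simp: strict_mono_less)

section \<open>Bottoms of ascending pairs and 123-avoidance\<close>

primrec asc_bottom :: "nat list \<Rightarrow> nat" where
  "asc_bottom [] = 0"
| "asc_bottom (b # w) = (if \<exists>c\<in>set w. b < c then max b (asc_bottom w) else asc_bottom w)"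

lemma subseq_Cons_Cons_iff:
  "subseq (x # xs) (y # ys) \<longleftrightarrow> x = y \<and> subseq xs ys \<or> subseq (x # xs) ys"
  by (metis subseq_Cons' subseq_Cons2_iff)

text \<open>A maximum is at most \<open>a\<close> iff all candidates are; the default 0 covers words
  without an ascending pair.\<close>

lemma asc_bottom_le_iff:
  "asc_bottom w \<le> a \<longleftrightarrow> (\<forall>b c. subseq [b, c] w \<and> b < c \<longrightarrow> b \<le> a)"
proof (induction w)
  case (Cons d w)
  have "(\<forall>b c. subseq [b, c] (d # w) \<and> b < c \<longrightarrow> b \<le> a) \<longleftrightarrow>
      (\<forall>c\<in>set w. d < c \<longrightarrow> d \<le> a) \<and> (\<forall>b c. subseq [b, c] w \<and> b < c \<longrightarrow> b \<le> a)"
    unfolding subseq_Cons_Cons_iff subseq_singleton_left by blast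
  also have "\<dots> \<longleftrightarrow> asc_bottom (d # w) \<le> a"
    unfolding Cons.IH[symmetric] by auto
  finally show ?case ..
qed simp

lemma avoids_123_iff:
  "avoids w [1, 2, 3] \<longleftrightarrow> \<not> (\<exists>a b c. subseq [a, b, c] w \<and> a < b \<and> b < c)"
  unfolding avoids_def red_eq_123_iff by blast

lemma avoids_123_Nil: "avoids ([] :: nat list) [1, 2, 3]"
  unfolding avoids_123_iff by simp

text \<open>An occurrence of 123 that uses the new first letter is \<open>a\<close> followed by an
  ascending pair whose bottom exceeds \<open>a\<close>.\<close>

lemma avoids_123_Cons:
  "avoids (a # w) [1, 2, 3] \<longleftrightarrow> avoids w [1, 2, 3] \<and> asc_bottom w \<le> a"
  unfolding avoids_123_iff asc_bottom_le_iff subseq_Cons_Cons_iff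
  by (simp only: not_le[symmetric]) blast

text \<open>Order-preserving maps commute with the maximum; \<open>0 < a\<close> makes the
  relabelling fix the default 0.\<close>

lemma asc_bottom_map_gap_map:
  assumes "0 < a"
  shows "asc_bottom (map (gap_map a) w) = gap_map a (asc_bottom w)"
proof (induction w)
  case (Cons b w)
  have "max (gap_map a u) (gap_map a v) = gap_map a (max u v)" for u v
    by (auto simp: gap_map_def)
  with Cons show ?case by simp
qed (use assms in \<open>simp add: gap_map_def\<close>)

lemma avoids_123_map_gap_map:
  assumes "0 < a"
  shows "avoids (map (gap_map a) w) [1, 2, 3] \<longleftrightarrow> avoids w [1, 2, 3]"
proof (induction w)
  case (Cons b w)
  have "gap_map a u \<le> gap_map a v \<longleftrightarrow> u \<le> v" for u v
    by (simp add: not_less[symmetric])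
  with Cons show ?case
    by (simp add: avoids_123_Cons asc_bottom_map_gap_map[OF assms] del: One_nat_def)
qed simp

text \<open>The inequality is strict because a bottom equal to \<open>a\<close> is relabelled to
  \<open>Suc a\<close>.\<close>

lemma avoids_123_prepend:
  assumes "0 < a"
  shows "avoids (prepend a \<pi>) [1, 2, 3] \<longleftrightarrow> avoids \<pi> [1, 2, 3] \<and> asc_bottom \<pi> < a"
  using assms
  by (simp add: prepend_def avoids_123_Cons avoids_123_map_gap_map asc_bottom_map_gap_map del: One_nat_def)

section \<open>Statistics of a prepended permutation\<close>

definition first_desc :: "nat list \<Rightarrow> bool" where
  "first_desc \<sigma> \<longleftrightarrow> 1 < length \<sigma> \<and> \<sigma> ! 1 < \<sigma> ! 0"

lemma des_prepend:
  assumes "\<pi> \<noteq> []"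
  shows "des (prepend a \<pi>) = of_bool (hd \<pi> < a) + des \<pi>"
proof -
  obtain b w where \<pi>: "\<pi> = b # w"
    using assms by (cases \<pi>) auto
  show ?thesis
    using des_map[OF strict_mono_gap_map[of a], of \<pi>]
    by (simp add: prepend_def \<pi> des_Cons_Cons)
qed

lemma mch_321_prepend:
  assumes "\<pi> \<noteq> []"
  shows "mch [3, 2, 1] (prepend a \<pi>) = of_bool (hd \<pi> < a \<and> first_desc \<pi>) + mch [3, 2, 1] \<pi>"
proof (cases "\<exists>b c w. \<pi> = b # c # w")
  case True
  then obtain b c w where \<pi>: "\<pi> = b # c # w" by blast
  show ?thesis
    using mch_321_map[OF strict_mono_gap_map[of a], of \<pi>]
    by (auto simp add: prepend_def \<pi> mch_321_Cons_Cons_Cons first_desc_def simp del: One_nat_def)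
next
  case False
  \<comment> \<open>A single letter becomes a word of length 2, still too short for a 321-match, and
    \<open>first_desc\<close> fails for it.\<close>
  then have "length \<pi> = 1"
    using assms by (cases \<pi>; cases "tl \<pi>") auto
  then show ?thesis unfolding mch_321 by (simp add: first_desc_def)
qed

definition weight :: "'a \<Rightarrow> 'a \<Rightarrow> nat list \<Rightarrow> 'a::comm_semiring_1" where
  "weight x y \<sigma> = y ^ des \<sigma> * x ^ mch [3, 2, 1] \<sigma>"

lemma weight_prepend:
  assumes "\<pi> \<noteq> []"
  shows "weight x y (prepend a \<pi>) =
    (if hd \<pi> < a then if first_desc \<pi> then x * y else y else 1) * weight x y \<pi>"
  unfolding weight_def des_prepend[OF assms] mch_321_prepend[OF assms]
  by (simp add: mult_ac)

text \<open>Some later letter exceeds \<open>a\<close> iff \<open>a\<close> is not the new maximum;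
  the old bottom lies below \<open>a\<close>, so relabelling fixes it.\<close>

lemma asc_bottom_prepend:
  assumes "set \<pi> = {1..n}" "asc_bottom \<pi> < a" "a \<le> Suc n"
  shows "asc_bottom (prepend a \<pi>) = (if a \<le> n then a else asc_bottom \<pi>)"
proof -
  have "(\<exists>c\<in>set (map (gap_map a) \<pi>). a < c) \<longleftrightarrow> a \<le> n"
    using assms by auto
  moreover have "asc_bottom (map (gap_map a) \<pi>) = asc_bottom \<pi>"
    using assms(2) by (subst asc_bottom_map_gap_map) (auto simp: gap_map_def)
  ultimately show ?thesis
    using assms(2) by (simp add: prepend_def)
qed

text \<open>A bottom has a larger letter after it, so it is not \<open>n\<close>.\<close>

lemma asc_bottom_less:
  assumes "\<pi> \<noteq> []" "set \<pi> \<subseteq> {1..n}"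
  shows "asc_bottom \<pi> < n"
  using assms
proof (induction \<pi>)
  case (Cons b w)
  show ?case
  proof (cases "w = []")
    case False
    with Cons show ?thesis by fastforce
  qed (use Cons.prems in auto)
qed simp

text \<open>If \<open>n\<close> is not first it comes later, so the first letter is a bottom, and
  avoidance keeps all other bottoms at or below it.\<close>

lemma hd_avoids_123:
  assumes "avoids \<pi> [1, 2, 3]" "set \<pi> = {1..n}" "0 < n"
  shows "hd \<pi> = n \<or> hd \<pi> = asc_bottom \<pi>"
proof -
  obtain b w where \<pi>: "\<pi> = b # w"
    using assms by (cases \<pi>) auto
  have "asc_bottom w \<le> b"
    using assms(1) by (simp add: \<pi> avoids_123_Cons del: One_nat_def)
  moreover have "b \<le> n" "n \<in> set \<pi>"
    using assms by (auto simp: \<pi>)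
  ultimately show ?thesis
    by (auto simp: \<pi>)
qed

text \<open>\<open>Top\<close>: the first letter is the largest one; \<open>Rise\<close> and \<open>Fall\<close>: the first letter is the largest
  bottom of an ascending pair, and the first step is an ascent or a descent, respectively.\<close>

datatype state = Single | Top | Rise | Fall

text \<open>Length 1 is separated from \<open>Top\<close>: its letter is also the largest, but no
  descent follows it, so a larger letter in front creates no 321-match.\<close>

definition state_of :: "nat list \<Rightarrow> state" where
  "state_of \<sigma> =
     (if length \<sigma> = 1 then Single else if hd \<sigma> = length \<sigma> then Top
      else if first_desc \<sigma> then Fall else Rise)"

text \<open>The number of admissible new letters other than the new maximum.\<close>

definition height :: "nat list \<Rightarrow> nat" where
  "height \<sigma> = length \<sigma> - asc_bottom \<sigma>"

text \<open>Factor for prepending a new maximum: always a descent, and a 321-match if a descent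
  already came first.\<close>

primrec top_weight :: "'a \<Rightarrow> 'a \<Rightarrow> state \<Rightarrow> 'a::comm_semiring_1" where
  "top_weight x y Single = y"
| "top_weight x y Top = x * y"
| "top_weight x y Rise = y"
| "top_weight x y Fall = x * y"

text \<open>Factor for any other admissible letter: it exceeds the old first letter exactly in the
  states \<open>Rise\<close> and \<open>Fall\<close>.\<close>

primrec low_weight :: "'a \<Rightarrow> 'a \<Rightarrow> state \<Rightarrow> 'a::comm_semiring_1" where
  "low_weight x y Single = 1"
| "low_weight x y Top = 1"
| "low_weight x y Rise = y"
| "low_weight x y Fall = x * y"

primrec low_state :: "state \<Rightarrow> state" where
  "low_state Single = Rise"
| "low_state Top = Rise"
| "low_state Rise = Fall"
| "low_state Fall = Fall"

text \<open>Total weight gained over all ways of prepending \<open>n\<close> letters, from state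
  \<open>s\<close> and height \<open>h\<close>; \<open>j\<close> is the height after a letter that
  is not a new maximum.\<close>

primrec extension_sum :: "'a \<Rightarrow> 'a \<Rightarrow> nat \<Rightarrow> state \<Rightarrow> nat \<Rightarrow> 'a::comm_semiring_1" where
  "extension_sum x y 0 s h = 1"
| "extension_sum x y (Suc n) s h =
     top_weight x y s * extension_sum x y n Top (Suc h) +
     low_weight x y s * (\<Sum>j=1..h. extension_sum x y n (low_state s) j)"

section \<open>Summation over all admissible prepended letters\<close>

lemma sum_prepend:
  assumes av: "\<pi> \<in> avoiding_perms n [1, 2, 3]" and n: "0 < n"
  shows "(\<Sum>a = Suc (asc_bottom \<pi>)..Suc n. weight x y (prepend a \<pi>) *
      extension_sum x y m (state_of (prepend a \<pi>)) (height (prepend a \<pi>))) =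
    weight x y \<pi> * extension_sum x y (Suc m) (state_of \<pi>) (height \<pi>)"
proof -
  let ?k = "asc_bottom \<pi>"
  define g where "g a = weight x y (prepend a \<pi>) *
      extension_sum x y m (state_of (prepend a \<pi>)) (height (prepend a \<pi>))" for a
  have set: "set \<pi> = {1..n}" and dist: "distinct \<pi>" and avoids: "avoids \<pi> [1, 2, 3]"
    using av by (auto simp: avoiding_perms_def permutations_of_set_def)
  have len: "length \<pi> = n"
    using distinct_card[OF dist] by (simp add: set)
  have ne: "\<pi> \<noteq> []"
    using len n by auto
  have k: "?k < n"
    using asc_bottom_less[OF ne] set by simp
  have hd_in: "hd \<pi> \<in> {1..n}"
    using hd_in_set[OF ne] set by simp
  have hd: "hd \<pi> = n \<or> hd \<pi> = ?k"
    using hd_avoids_123[OF avoids set n] .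
  \<comment> \<open>The second letter differs from the largest one, hence is smaller.\<close>
  have first: "first_desc \<pi>" if "hd \<pi> = n" "n \<noteq> 1"
  proof -
    have "\<pi> ! 1 \<in> set \<pi>" "\<pi> ! 0 \<noteq> \<pi> ! 1"
      using that n len dist by (auto simp: nth_eq_iff_index_eq)
    then show ?thesis
      using that n ne len set by (auto simp: first_desc_def hd_conv_nth)
  qed
  have first_prepend: "first_desc (prepend a \<pi>) \<longleftrightarrow> hd \<pi> < a" for a
    using ne len by (auto simp: first_desc_def prepend_def hd_conv_nth)
  have hd_prepend: "hd (prepend a \<pi>) = a" for a
    by (simp add: prepend_def)
  have not_first_Single: "\<not> first_desc \<pi>" if "n = 1"
    using that len by (simp add: first_desc_def)
  have top: "g (Suc n) = weight x y \<pi> * (top_weight x y (state_of \<pi>) *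
      extension_sum x y m Top (Suc (height \<pi>)))"
  proof -
    have "state_of (prepend (Suc n) \<pi>) = Top"
      using n by (simp add: state_of_def len hd_prepend)
    moreover have "height (prepend (Suc n) \<pi>) = Suc (height \<pi>)"
      using asc_bottom_prepend[OF set, of "Suc n"] k by (simp add: height_def len)
    moreover have "weight x y (prepend (Suc n) \<pi>) = top_weight x y (state_of \<pi>) * weight x y \<pi>"
      using hd_in first not_first_Single
      by (auto simp: weight_prepend[OF ne] state_of_def len)
    ultimately show ?thesis by (simp add: g_def mult_ac)
  qed
  have low: "g a = weight x y \<pi> * (low_weight x y (state_of \<pi>) *
      extension_sum x y m (low_state (state_of \<pi>)) (Suc n - a))" if a: "a \<in> {Suc ?k..n}" for a
  proof -
    \<comment> \<open>The first letter is \<open>n\<close>, which is at least \<open>a\<close>, or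
      the ascent bottom, which is below \<open>a\<close>.\<close>
    have less: "hd \<pi> < a \<longleftrightarrow> hd \<pi> \<noteq> n"
      using hd a by auto
    have "state_of (prepend a \<pi>) = (if hd \<pi> < a then Fall else Rise)"
      using a n by (simp add: state_of_def len hd_prepend first_prepend)
    also have "\<dots> = low_state (state_of \<pi>)"
      using less hd_in by (auto simp: state_of_def len)
    finally have "state_of (prepend a \<pi>) = low_state (state_of \<pi>)" .
    moreover have "height (prepend a \<pi>) = Suc n - a"
      using asc_bottom_prepend[OF set, of a] a by (simp add: height_def len)
    moreover have "weight x y (prepend a \<pi>) = low_weight x y (state_of \<pi>) * weight x y \<pi>"
      using less hd_in by (auto simp: weight_prepend[OF ne] state_of_def len)
    ultimately show ?thesis by (simp add: g_def mult_ac)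
  qed
  \<comment> \<open>Reindexing by the new height \<open>j = Suc n - a\<close>, which runs through
    \<open>1..height \<pi>\<close>.\<close>
  have "(\<Sum>a = Suc ?k..n. extension_sum x y m (low_state (state_of \<pi>)) (Suc n - a)) =
      (\<Sum>j=1..height \<pi>. extension_sum x y m (low_state (state_of \<pi>)) j)"
    by (rule sum.reindex_bij_witness[of _ "\<lambda>j. Suc n - j" "\<lambda>a. Suc n - a"])
      (use k in \<open>auto simp: height_def len\<close>)
  then have "(\<Sum>a = Suc ?k..n. g a) = weight x y \<pi> * (low_weight x y (state_of \<pi>) *
      (\<Sum>j=1..height \<pi>. extension_sum x y m (low_state (state_of \<pi>)) j))"
    by (simp add: low sum_distrib_left[symmetric])
  moreover have "(\<Sum>a = Suc ?k..Suc n. g a) = g (Suc n) + (\<Sum>a = Suc ?k..n. g a)"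
    using k by (simp add: add.commute)
  ultimately show ?thesis
    unfolding g_def[symmetric] top by (simp add: distrib_left)
qed

lemma avoiding_perms_Suc:
  "avoiding_perms (Suc n) [1, 2, 3] =
     (\<lambda>(\<pi>, a). prepend a \<pi>) ` (SIGMA \<pi>:avoiding_perms n [1, 2, 3]. {Suc (asc_bottom \<pi>)..Suc n})"
  unfolding avoiding_perms_def permutations_of_set_Suc
  by (auto simp: avoids_123_prepend image_iff simp del: One_nat_def)

lemma inj_on_prepend: "inj_on (\<lambda>(\<pi>, a). prepend a \<pi>) A"
  by (auto simp: inj_on_def prepend_def inj_map_eq_map[OF strict_mono_imp_inj_on[OF strict_mono_gap_map]])

lemma finite_avoiding_perms: "finite (avoiding_perms n \<tau>)"
  unfolding avoiding_perms_def by simp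

lemma sum_avoiding_perms_Suc:
  "(\<Sum>\<sigma>\<in>avoiding_perms (Suc n) [1, 2, 3]. g \<sigma>) =
     (\<Sum>\<pi>\<in>avoiding_perms n [1, 2, 3]. \<Sum>a = Suc (asc_bottom \<pi>)..Suc n. g (prepend a \<pi>))"
  unfolding avoiding_perms_Suc
  by (subst sum.reindex[OF inj_on_prepend])
    (simp add: sum.Sigma finite_avoiding_perms case_prod_unfold del: sum.cl_ivl_Suc One_nat_def)

lemma avoiding_perms_0: "avoiding_perms 0 [1, 2, 3] = {[]}"
  unfolding avoiding_perms_def by (auto simp: avoids_123_Nil simp del: One_nat_def)

lemma avoiding_perms_1: "avoiding_perms (Suc 0) [1, 2, 3] = {[1]}"
  unfolding avoiding_perms_Suc avoiding_perms_0 by (simp add: prepend_def Sigma_def)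

lemma weight_Nil: "weight x y [] = 1"
  unfolding weight_def mch_321 by (simp add: des_def)

lemma weight_singleton: "weight x y [a] = 1"
  unfolding weight_def mch_321 by (simp add: des_def)

text \<open>Moving letters from the extension into the permutation preserves the total; the start is
  the permutation \<open>[1]\<close>, of height 1.\<close>

lemma sum_weight_extension_sum:
  "(\<Sum>\<sigma>\<in>avoiding_perms (Suc n) [1, 2, 3]. weight x y \<sigma> *
      extension_sum x y m (state_of \<sigma>) (height \<sigma>)) = extension_sum x y (n + m) Single 1"
proof (induction n arbitrary: m)
  case 0
  show ?case
    unfolding avoiding_perms_1
    by (simp add: weight_singleton state_of_def height_def)
next
  case (Suc n)
  show ?case
    unfolding sum_avoiding_perms_Suc[of _ "Suc n"]
    using Suc.IH[of "Suc m"] by (simp add: sum_prepend del: extension_sum.simps sum.cl_ivl_Suc One_nat_def)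
qed

lemma sum_weight_avoiding_perms:
  "(\<Sum>\<sigma>\<in>avoiding_perms (Suc n) [1, 2, 3]. weight x y \<sigma>) = extension_sum x y n Single 1"
  using sum_weight_extension_sum[where m = 0] by simp

subsection \<open>Solving the linear system\<close>

text \<open>The equations at \<open>h = 0\<close> for \<open>Top\<close>, \<open>Rise\<close> and
  \<open>Fall\<close>, in this order. In the last two the sides differ by an explicit multiple of
  the equation for \<open>U\<close>.\<close>

lemma closed_form_base:
  fixes t x y U :: "'a::comm_ring_1"
  assumes E: "E = x + t - t * x^2 * y" and a: "a = 1 + t - t * x * y"
    and q: "q = 1 - t * x * y * U"
    and U: "t * y * E * U^2 = U - 1"
  shows "q * (a * (x^2 * y - 1) - t * (x - 1) * y * E) + a =
      y * E^2 * q + t * (x * y * (q * (a * (x^2 * y - 1)) + a * U))"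
    and "y * E * q * ((x - 1) * (1 - t * x * y) + a * U) =
      y * E^2 * q + t * (y * (q * (a * (x^2 * y - 1)) + a * U))"
    and "y * E * q * (x * a * U - t * (x - 1)) =
      y * E^2 * q + t * (x * y * (q * (a * (x^2 * y - 1)) + a * U))"
proof -
  show "q * (a * (x^2 * y - 1) - t * (x - 1) * y * E) + a =
      y * E^2 * q + t * (x * y * (q * (a * (x^2 * y - 1)) + a * U))"
    unfolding E a q by (simp add: algebra_simps power2_eq_square)
  have "y * E * q * ((x - 1) * (1 - t * x * y) + a * U) -
      (y * E^2 * q + t * (y * (q * (a * (x^2 * y - 1)) + a * U))) =
      (- (x * y * a)) * (t * y * E * U^2 - (U - 1))"
    unfolding E a q by (simp add: algebra_simps power2_eq_square)
  then show "y * E * q * ((x - 1) * (1 - t * x * y) + a * U) =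
      y * E^2 * q + t * (y * (q * (a * (x^2 * y - 1)) + a * U))"
    using U by simp
  have "y * E * q * (x * a * U - t * (x - 1)) -
      (y * E^2 * q + t * (x * y * (q * (a * (x^2 * y - 1)) + a * U))) =
      (- (x^2 * y * a)) * (t * y * E * U^2 - (U - 1))"
    unfolding E a q by (simp add: algebra_simps power2_eq_square)
  then show "y * E * q * (x * a * U - t * (x - 1)) =
      y * E^2 * q + t * (x * y * (q * (a * (x^2 * y - 1)) + a * U))"
    using U by simp
qed

text \<open>The equation for \<open>U\<close> in the form that eliminating states from the
  homogeneous system yields; it exhibits a factor \<open>q\<close> in
  \<open>t^2 * y * U^2\<close>.\<close>

lemma kernel_eq:
  fixes t x y U :: "'a::comm_ring_1"
  assumes E: "E = x + t - t * x^2 * y" and q: "q = 1 - t * x * y * U"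
    and U: "t * y * E * U^2 = U - 1"
  shows "q * (U - 2 + q) = t^2 * y * U^2"
proof -
  have "q * (U - 2 + q) - t^2 * y * U^2 = U - 1 - t * y * E * U^2"
    unfolding E q by (simp add: algebra_simps power2_eq_square)
  then show ?thesis
    using U by simp
qed

text \<open>The equations at consecutive heights subtracted, for \<open>Top\<close>,
  \<open>Rise\<close> and \<open>Fall\<close>, with \<open>P\<close> standing for
  \<open>U^h\<close>. Again the sides differ by a multiple of the equation for
  \<open>U\<close>.\<close>

lemma closed_form_step:
  fixes t x y U :: "'a::comm_ring_1"
  assumes E: "E = x + t - t * x^2 * y" and q: "q = 1 - t * x * y * U"
    and U: "t * y * E * U^2 = U - 1"
  shows "a * P * (U - 1) + q * ((x - 1) * t * y * E) =
      t * (x * y * (a * P * U * (U - 1) + q * ((x - 1) * t * y * E)) +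
        y * E * q * ((x - 1) * (1 - t * x * y) + a * P * U^2))"
    and "y * E * q * (a * P * U * (U - 1)) =
      t * (y * (a * P * U * (U - 1) + q * ((x - 1) * t * y * E)) +
        y * (y * E * q * (x * a * P * U^2 - t * (x - 1))))"
    and "y * E * q * (x * a * P * U * (U - 1)) =
      t * (x * y * (a * P * U * (U - 1) + q * ((x - 1) * t * y * E)) +
        x * y * (y * E * q * (x * a * P * U^2 - t * (x - 1))))"
proof -
  have "a * P * (U - 1) + q * ((x - 1) * t * y * E) -
      (t * (x * y * (a * P * U * (U - 1) + q * ((x - 1) * t * y * E)) +
        y * E * q * ((x - 1) * (1 - t * x * y) + a * P * U^2))) =
      (- (a * P * q)) * (t * y * E * U^2 - (U - 1))"
    unfolding E q by (simp add: algebra_simps power2_eq_square)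
  then show "a * P * (U - 1) + q * ((x - 1) * t * y * E) =
      t * (x * y * (a * P * U * (U - 1) + q * ((x - 1) * t * y * E)) +
        y * E * q * ((x - 1) * (1 - t * x * y) + a * P * U^2))"
    using U by simp
  have "y * E * q * (a * P * U * (U - 1)) -
      (t * (y * (a * P * U * (U - 1) + q * ((x - 1) * t * y * E)) +
        y * (y * E * q * (x * a * P * U^2 - t * (x - 1))))) =
      (y * a * P * U * (t - E)) * (t * y * E * U^2 - (U - 1))"
    unfolding E q by (simp add: algebra_simps power2_eq_square)
  then show "y * E * q * (a * P * U * (U - 1)) =
      t * (y * (a * P * U * (U - 1) + q * ((x - 1) * t * y * E)) +
        y * (y * E * q * (x * a * P * U^2 - t * (x - 1))))"
    using U by simp
  have "y * E * q * (x * a * P * U * (U - 1)) -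
      (t * (x * y * (a * P * U * (U - 1) + q * ((x - 1) * t * y * E)) +
        x * y * (y * E * q * (x * a * P * U^2 - t * (x - 1))))) =
      (x * y * a * P * U * (t - E)) * (t * y * E * U^2 - (U - 1))"
    unfolding E q by (simp add: algebra_simps power2_eq_square)
  then show "y * E * q * (x * a * P * U * (U - 1)) =
      t * (x * y * (a * P * U * (U - 1) + q * ((x - 1) * t * y * E)) +
        x * y * (y * E * q * (x * a * P * U^2 - t * (x - 1))))"
    using U by simp
qed

section \<open>Uniqueness of the power series solution\<close>

lemma transfer_system_zero:
  fixes G :: "state \<Rightarrow> nat \<Rightarrow> 'a::comm_ring_1 fps"
  assumes G: "\<And>s h. s \<noteq> Single \<Longrightarrow>
    G s h = fps_X * (v s * G Top (Suc h) + w s * (\<Sum>j=1..h. G (low_state s) j))"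
    and "s \<noteq> Single"
  shows "G s h = 0"
proof -
  have "fps_nth (G s h) n = 0" if "s \<noteq> Single" for n s h
    using that
  \<comment> \<open>The factor \<open>fps_X\<close> reduces each coefficient to lower ones;
    \<open>h\<close> stays arbitrary since the equation refers to height
    \<open>Suc h\<close>.\<close>
  proof (induction n arbitrary: s h rule: less_induct)
    case (less n)
    have low: "low_state s \<noteq> Single"
      by (cases s) auto
    show ?case
    proof (cases n)
      case (Suc m)
      have "fps_nth (v s * G Top (Suc h)) m = 0"
        using less.IH[of _ Top] by (simp add: fps_mult_nth Suc)
      moreover have "fps_nth (w s * (\<Sum>j=1..h. G (low_state s) j)) m = 0"
        using less.IH[OF _ low] by (simp add: fps_mult_nth fps_sum_nth Suc)
      ultimately show ?thesis
        by (subst G[OF less.prems]) (simp add: Suc)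
    qed (subst G[OF less.prems], simp)
  qed
  then show ?thesis
    using assms(2) by (intro fps_ext) simp
qed

text \<open>\<open>d * F - C\<close> solves the homogeneous system; the scaling by \<open>d\<close>
  permits solutions with a denominator.\<close>

lemma transfer_system_unique:
  fixes F :: "state \<Rightarrow> nat \<Rightarrow> 'a::comm_ring_1 fps"
  assumes F: "\<And>s h. s \<noteq> Single \<Longrightarrow>
      F s h = 1 + fps_X * (v s * F Top (Suc h) + w s * (\<Sum>j=1..h. F (low_state s) j))"
    and C: "\<And>s h. s \<noteq> Single \<Longrightarrow>
      C s h = d + fps_X * (v s * C Top (Suc h) + w s * (\<Sum>j=1..h. C (low_state s) j))"
    and s: "s \<noteq> Single"
  shows "d * F s h = C s h"
proof -
  have "d * F s h - C s h = 0"
  proof (rule transfer_system_zero[of "\<lambda>s h. d * F s h - C s h", OF _ s])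
    fix s h assume "s \<noteq> Single"
    then show "d * F s h - C s h = fps_X * (v s * (d * F Top (Suc h) - C Top (Suc h)) +
        w s * (\<Sum>j=1..h. d * F (low_state s) j - C (low_state s) j))"
      by (subst F, simp, subst C, simp)
        (simp add: sum_subtractf sum_distrib_left[symmetric] algebra_simps)
  qed
  then show ?thesis by simp
qed

section \<open>Generating functions and their closed form\<close>

definition extension_fps :: "'a \<Rightarrow> 'a \<Rightarrow> state \<Rightarrow> nat \<Rightarrow> 'a::comm_ring_1 fps" where
  "extension_fps x y s h = Abs_fps (\<lambda>n. extension_sum x y n s h)"

lemma extension_fps_rec:
  "extension_fps x y s h = 1 + fps_X *
     (top_weight (fps_const x) (fps_const y) s * extension_fps x y Top (Suc h) +
      low_weight (fps_const x) (fps_const y) s * (\<Sum>j=1..h. extension_fps x y (low_state s) j))"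
proof (rule fps_ext)
  fix n
  have "top_weight (fps_const x) (fps_const y) s = fps_const (top_weight x y s)"
    "low_weight (fps_const x) (fps_const y) s = fps_const (low_weight x y s)"
    by (cases s; simp)+
  then show "fps_nth (extension_fps x y s h) n = fps_nth (1 + fps_X *
     (top_weight (fps_const x) (fps_const y) s * extension_fps x y Top (Suc h) +
      low_weight (fps_const x) (fps_const y) s * (\<Sum>j=1..h. extension_fps x y (low_state s) j))) n"
    by (cases n) (simp_all add: extension_fps_def fps_sum_nth)
qed

text \<open>The factor \<open>y * E^2 * q\<close> clears the denominators of the solution.\<close>

lemma closed_form_system:
  fixes t x y U :: "'a::comm_ring_1"
  assumes E: "E = x + t - t * x^2 * y" and a: "a = 1 + t - t * x * y" and q: "q = 1 - t * x * y * U"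
    and U: "t * y * E * U^2 = U - 1"
    and C_Top: "\<And>h. C Top h =
      q * (a * (x^2 * y - 1) + (x - 1) * t * y * E * (of_nat h - 1)) + a * U^h"
    and C_Rise: "\<And>h. C Rise h = y * E * q * ((x - 1) * (1 - t * x * y) + a * U^Suc h)"
    and C_Fall: "\<And>h. C Fall h = y * E * q * (x * a * U^Suc h - t * (x - 1))"
    and s: "s \<noteq> Single"
  shows "C s h = y * E^2 * q +
    t * (top_weight x y s * C Top (Suc h) + low_weight x y s * (\<Sum>j=1..h. C (low_state s) j))"
proof (induction h)
  case 0
  show ?case
    using closed_form_base[OF E a q U] s
    by (cases s) (simp_all add: C_Top C_Rise C_Fall algebra_simps)
next
  case (Suc h)
  define P where "P = U ^ h"
  have Top_diff: "C Top (Suc h) - C Top h = a * P * (U - 1) + q * ((x - 1) * t * y * E)"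
    "C Top (Suc (Suc h)) - C Top (Suc h) = a * P * U * (U - 1) + q * ((x - 1) * t * y * E)"
    by (simp_all add: C_Top P_def algebra_simps)
  have Rise_diff: "C Rise (Suc h) - C Rise h = y * E * q * (a * P * U * (U - 1))"
    and Fall_diff: "C Fall (Suc h) - C Fall h = y * E * q * (x * a * P * U * (U - 1))"
    by (simp_all add: C_Rise C_Fall P_def algebra_simps)
  have Rise_Suc: "C Rise (Suc h) = y * E * q * ((x - 1) * (1 - t * x * y) + a * P * U^2)"
    and Fall_Suc: "C Fall (Suc h) = y * E * q * (x * a * P * U^2 - t * (x - 1))"
    by (simp_all add: C_Rise C_Fall P_def algebra_simps power2_eq_square)
  \<comment> \<open>Differencing in \<open>h\<close> removes the constant and leaves only the last
    term of the sum.\<close>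
  have "C s (Suc h) - C s h = t * (top_weight x y s * (C Top (Suc (Suc h)) - C Top (Suc h)) +
      low_weight x y s * C (low_state s) (Suc h))"
  proof (cases s)
    case Top
    then show ?thesis
      using closed_form_step(1)[OF E q U, of a P] by (simp add: Top_diff Rise_Suc)
  next
    case Rise
    then show ?thesis
      using closed_form_step(2)[OF E q U, of a P] by (simp add: Top_diff Rise_diff Fall_Suc)
  next
    case Fall
    show ?thesis
      unfolding Fall top_weight.simps low_weight.simps low_state.simps Top_diff Fall_diff
      unfolding Fall_Suc by (rule closed_form_step(3)[OF E q U])
  qed (use s in simp)
  moreover have "C s (Suc h) = C s h + (C s (Suc h) - C s h)"
    by simp
  ultimately have "C s (Suc h) = C s h +
      t * (top_weight x y s * (C Top (Suc (Suc h)) - C Top (Suc h)) +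
      low_weight x y s * C (low_state s) (Suc h))"
    by simp
  also have "\<dots> = y * E^2 * q + t * (top_weight x y s * C Top (Suc (Suc h)) +
      low_weight x y s * (\<Sum>j=1..Suc h. C (low_state s) j))"
    by (subst Suc.IH) (simp add: algebra_simps)
  finally show ?case .
qed

lemma A_series_eq_extension_fps:
  "A_series = 1 + fps_X * extension_fps var_x var_y Single 1"
proof (rule fps_ext)
  fix n
  show "fps_nth A_series n = fps_nth (1 + fps_X * extension_fps var_x var_y Single 1) n"
    using sum_weight_avoiding_perms[of var_x var_y "n - 1"]
    by (cases n) (simp_all add: A_series_def extension_fps_def weight_def[symmetric]
        avoiding_perms_0 weight_Nil del: One_nat_def)
qed

lemma A_series_closed_form:
  fixes t x y U :: "rat poly poly fps"
  assumes t: "t = fps_X" and x: "x = fps_const var_x" and y: "y = fps_const var_y"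
    and E: "E = x + t - t * x^2 * y" and a: "a = 1 + t - t * x * y"
    and U: "t * y * E * U^2 = U - 1"
  shows "y * E^2 * A_series = y * E^2 * (1 + t) +
    t^2 * y * (a * (x^2 * y - 1) + (x - 1) * t * y * E) +
    t^2 * y * E * (x - 1) * (1 - t * x * y) + a * (a * U - (1 + t))"
proof -
  define q where "q = 1 - t * x * y * U"
  \<comment> \<open>Combinations of the characteristic solutions \<open>1\<close>, \<open>h\<close>
    and \<open>U^h\<close>, scaled by \<open>y * E^2 * q\<close>; \<open>Rise\<close> and
    \<open>Fall\<close> carry no linear term in \<open>h\<close>.\<close>
  define C where "C s h = (case s of
      Top \<Rightarrow> q * (a * (x^2 * y - 1) + (x - 1) * t * y * E * (of_nat h - 1)) + a * U^h
    | Rise \<Rightarrow> y * E * q * ((x - 1) * (1 - t * x * y) + a * U^Suc h)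
    | Fall \<Rightarrow> y * E * q * (x * a * U^Suc h - t * (x - 1))
    | Single \<Rightarrow> 0)" for s and h :: nat
  let ?F = "extension_fps var_x var_y"
  have F: "y * E^2 * q * ?F s h = C s h" if "s \<noteq> Single" for s h
  proof (rule transfer_system_unique[OF _ _ that])
    show "?F s h = 1 + fps_X * (top_weight x y s * ?F Top (Suc h) +
        low_weight x y s * (\<Sum>j=1..h. ?F (low_state s) j))" for s h
      unfolding x y by (rule extension_fps_rec)
    show "C s h = y * E^2 * q + fps_X * (top_weight x y s * C Top (Suc h) +
        low_weight x y s * (\<Sum>j=1..h. C (low_state s) j))" if "s \<noteq> Single" for s h
      unfolding t[symmetric]
      by (rule closed_form_system[OF E a q_def U _ _ _ that]) (simp_all add: C_def)
  qed
  \<comment> \<open>One unrolling leaves \<open>Single\<close>: only \<open>Top\<close> at height 2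
    and \<open>Rise\<close> at height 1 remain.\<close>
  have "?F Single 1 = 1 + t * (y * ?F Top 2 + ?F Rise 1)"
    by (subst extension_fps_rec) (simp add: t y numeral_2_eq_2)
  then have A: "A_series = 1 + t * (1 + t * (y * ?F Top 2 + ?F Rise 1))"
    by (simp add: A_series_eq_extension_fps t)
  have "y * E^2 * q * A_series = y * E^2 * q * (1 + t) +
      t^2 * (y * (y * E^2 * q * ?F Top 2) + y * E^2 * q * ?F Rise 1)"
    by (subst A) (simp add: algebra_simps power2_eq_square)
  also have "\<dots> = y * E^2 * q * (1 + t) + t^2 * (y * C Top 2 + C Rise 1)"
    by (simp add: F)
  also have "\<dots> = q * (y * E^2 * (1 + t) + t^2 * y * (a * (x^2 * y - 1) + (x - 1) * t * y * E) +
      t^2 * y * E * (x - 1) * (1 - t * x * y)) + a * (t^2 * y * U^2) + q * (t * a * (t * y * E * U^2))"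
    by (simp add: C_def algebra_simps power2_eq_square)
  \<comment> \<open>\<open>kernel_eq\<close> rewrites \<open>t^2 * y * U^2\<close>, the one part
    without a visible factor \<open>q\<close>, so \<open>q\<close> can be cancelled.\<close>
  also have "\<dots> = q * (y * E^2 * (1 + t) + t^2 * y * (a * (x^2 * y - 1) + (x - 1) * t * y * E) +
      t^2 * y * E * (x - 1) * (1 - t * x * y) + a * (U - 2 + q + t * (U - 1)))"
    unfolding kernel_eq[OF E q_def U, symmetric] U by (simp add: algebra_simps)
  also have "U - 2 + q + t * (U - 1) = a * U - (1 + t)"
    by (simp add: q_def a algebra_simps)
  finally have "q * (y * E^2 * A_series) = q * (y * E^2 * (1 + t) +
      t^2 * y * (a * (x^2 * y - 1) + (x - 1) * t * y * E) +
      t^2 * y * E * (x - 1) * (1 - t * x * y) + a * (a * U - (1 + t)))"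
    by (simp only: mult_ac)
  moreover have "q \<noteq> 0"
  proof
    assume "q = 0"
    moreover have "fps_nth q 0 = 1"
      by (simp add: q_def t)
    ultimately show False by simp
  qed
  ultimately show ?thesis
    by simp
qed

theorem theorem3:
  fixes t x y :: "rat poly poly fps"
  assumes "t = fps_X" and "x = fps_const var_x" and "y = fps_const var_y"
  shows "to_fract A_series = 1 -
    1 / to_fract (2 * t * y^2 * (- (x^2 * t * y) + x + t)^3) *
    to_fract (
        2 * (x - 1)^2 * t^6 * y^3 * (x^2 * y - 1)^2
      + t^2 * (- (x^2 * (2 * x + 5) * y^2) + (6 * x + 2) * y - 1)
      + 2 * t^4 * y * ((2 - 3 * x) * x^4 * y^3 + (3 * x^2 + 2 * x - 2) * x^2 * y^2
                       - (3 * x^2 + x - 1) * y + 1)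
      + 2 * (x - 1) * t^5 * y^2 * (x^5 * y^3 - 3 * x^4 * y^2 + 4 * x^2 * y - x * y - 1)
      + 2 * t^3 * y * (3 * x^4 * y^2 - x^3 * y - 5 * x^2 * y + x + 2)
      + t * (4 * x * y - 2) - 1
      + (t * (x * y - 1) - 1)^2
        * sqrt_fps (4 * x^2 * t^2 * y^2 - 4 * x * t * y - 4 * t^2 * y + 1))"
    (is "_ = 1 - 1 / to_fract ?den * to_fract (?num + _ * sqrt_fps ?disc)")
proof -
  define S where "S = sqrt_fps ?disc"
  define E where "E = x + t - t * x^2 * y"
  define a where "a = 1 + t - t * x * y"
  \<comment> \<open>\<open>1 + S\<close> has constant term 2, a unit of the coefficient ring with
    inverse 1/2; thus \<open>U = 2 / (1 + S)\<close>.\<close>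
  define R where "R = fps_right_inverse (1 + S) [:[:1 / 2:]:]"
  define U where "U = 2 * R"
  have "fps_nth ?disc 0 = 1"
    by (simp add: assms(1) power2_eq_square)
  then have S2: "S^2 = 1 - 4 * t * y * E" and S0: "fps_nth S 0 = 1"
    using sqrt_fps[of ?disc] by (simp_all add: S_def E_def algebra_simps power2_eq_square)
  have "(2 :: rat poly poly) * [:[:1 / 2:]:] = 1"
    by (simp add: numeral_poly one_pCons)
  then have "(1 + S) * R = 1"
    unfolding R_def by (intro fps_right_inverse) (simp add: S0)
  then have SU: "(1 + S) * U = 2"
    by (simp add: U_def mult.left_commute)
  then have S_nz: "1 + S \<noteq> 0"
    by auto
  \<comment> \<open>Both sides are \<open>1 - S^2 = 4 * t * y * E\<close>; cancelling
    \<open>1 + S\<close> makes \<open>U\<close> times \<open>2 * t * y * E\<close> linear in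
    \<open>S\<close>.\<close>
  have "(1 + S) * (1 - S) = 2 * t * y * E * ((1 + S) * U)"
    unfolding SU using S2 by (simp add: algebra_simps power2_eq_square)
  also have "\<dots> = (1 + S) * (2 * t * y * E * U)"
    by (simp only: mult_ac)
  finally have S_U: "1 - S = 2 * t * y * E * U"
    using S_nz by simp
  have "2 * (t * y * E * U^2) = 2 * t * y * E * U * U"
    by (simp add: power2_eq_square)
  also have "\<dots> = (1 - S) * U"
    by (simp add: S_U)
  also have "\<dots> = 2 * (U - 1)"
    using SU by (simp add: algebra_simps)
  finally have U: "t * y * E * U^2 = U - 1"
    by (simp only: mult_cancel_left) simp
  have den_eq: "?den = 2 * t * y^2 * E^3"
    by (simp add: E_def algebra_simps)
  have "?den * A_series = 2 * t * y * E * (y * E^2 * A_series)"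
    unfolding den_eq by (simp add: power2_eq_square power3_eq_cube mult_ac)
  \<comment> \<open>The terms with \<open>U\<close> are collected into
    \<open>2 * t * y * E * U = 1 - S\<close>; their coefficient \<open>a^2\<close> is that of the
    square root.\<close>
  also have "\<dots> = 2 * t * y * E * (y * E^2 * (1 + t) +
      t^2 * y * (a * (x^2 * y - 1) + (x - 1) * t * y * E) +
      t^2 * y * E * (x - 1) * (1 - t * x * y) - a * (1 + t)) + a^2 * (2 * t * y * E * U)"
    unfolding A_series_closed_form[OF assms E_def a_def U]
    by (simp add: algebra_simps power2_eq_square)
  also have "\<dots> = ?den - (?num + (t * (x * y - 1) - 1)^2 * S)"
    unfolding S_U[symmetric] unfolding E_def a_def
    by (simp add: algebra_simps eval_nat_numeral)
  finally have num: "?num + (t * (x * y - 1) - 1)^2 * S = ?den * (1 - A_series)"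
    by (simp add: algebra_simps)
  \<comment> \<open>The constant term of \<open>E\<close> is \<open>var_x\<close>, so the
    denominator is nonzero and may be cancelled in the fraction field.\<close>
  have "fps_nth E 0 \<noteq> 0" "var_y \<noteq> 0"
    by (simp_all add: E_def assms(1,2) var_x_def var_y_def)
  then have "E \<noteq> 0" "y \<noteq> 0"
    by (auto simp: assms(3))
  then have "?den \<noteq> 0"
    unfolding den_eq by (simp add: assms(1))
  then show ?thesis
    unfolding S_def[symmetric] num by simp
qed

end
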